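(* Let $f:M\to\mathbb{S}^3\times\mathbb{S}^3$, $f=(p,q)$, be a Lagrangian immersion into the nearly Kähler manifold $\mathbb{S}^3\times\mathbb{S}^3$ with angle functions $\theta_1,\theta_2,\theta_3$ and eigenvectors $E_1,E_2,E_3$. Then $\tilde f:M\to\mathbb{S}^3\times\mathbb{S}^3$ given by $\tilde f=(q,p)$ satisfies: (i) $\tilde f$ is a Lagrangian immersion; (ii) $f$ and $\tilde f$ induce the same metric on $M$; (iii) $E_1,E_2,E_3$ are also eigendirections of the operators $\tilde A,\tilde B$ corresponding to the immersion $\tilde f$, and the angle functions $\tilde\theta_1,\tilde\theta_2,\tilde\theta_3$ of $\tilde f$ (with $\tilde\theta_i$ corresponding to $E_i$) are given by $\tilde\theta_i=\pi-\theta_i$ for $i=1,2,3$.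
   Context: Identify $\mathbb{S}^3$ with the unit quaternions in $\mathbb{H}\cong\mathbb{R}^4$, with Euclidean metric $\langle\cdot,\cdot\rangle$; tangent vectors at $p$ are $p\alpha$ with $\alpha$ an imaginary quaternion. For $(U,V)\in T_{(p,q)}(\mathbb{S}^3\times\mathbb{S}^3)\cong T_p\mathbb{S}^3\oplus T_q\mathbb{S}^3$ define the almost complex structure $$J(U,V)_{(p,q)}=\tfrac{1}{\sqrt3}\left(2pq^{-1}V-U,\,-2qp^{-1}U+V\right),$$ and the metric $g(Z,Z')=\frac12(\langle Z,Z'\rangle+\langle JZ,JZ'\rangle)$, where $\langle\cdot,\cdot\rangle$ is the usual Euclidean product metric on $\mathbb{S}^3\times\mathbb{S}^3$. With $(g,J)$, $\mathbb{S}^3\times\mathbb{S}^3$ is a nearly Kähler manifold. Define also the almost product structure $P(U,V)_{(p,q)}=(pq^{-1}V,\,qp^{-1}U)$. An immersion $f:M\to\mathbb{S}^3\times\mathbb{S}^3$ is Lagrangian if $\dim M=3$ and $J$ maps $df(T_xM)$ into the $g$-normal space for every $x\in M$. $M$ carries the induced metric $f^*g$. For a Lagrangian immersion there are symmetric endomorphisms $A,B$ of $TM$ (the operators corresponding to $f$) with $P\,df(X)=df(AX)+J\,df(BX)$; they commute and satisfy $A^2+B^2=\mathrm{Id}$. Hence around each point of an open dense subset of $M$ there is a local orthonormal frame $E_1,E_2,E_3$ (the eigenvectors) and functions $\theta_1,\theta_2,\theta_3$ (the angle functions, each determined modulo $\pi$) such that $AE_i=\cos(2\theta_i)E_i$ and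 $BE_i=\sin(2\theta_i)E_i$, i.e. $P\,df(E_i)=\cos(2\theta_i)\,df(E_i)+\sin(2\theta_i)\,J\,df(E_i)$, for $i=1,2,3$. Equalities between angle functions are understood modulo $\pi$. *)

theory Defs
  imports "HOL-Analysis.Analysis" "HOL-Library.Real_Mod"
begin

subsection \<open>Quaternions\<close>

text \<open>
  The quaternion \<open>a + b i + c j + d k\<close> is the vector \<open>(a, b, c, d)\<close>, so that the inner product
  of \<^typ>\<open>real^4\<close> is the Euclidean one and \<open>\<S>\<^sup>3\<close> is \<^term>\<open>sphere (0::real^4) 1\<close>.
  The library's \<open>*\<close> on \<^typ>\<open>real^4\<close> is the componentwise product, hence the separate symbol.
\<close>

type_synonym quat = "real^4"

definition qmult :: "quat \<Rightarrow> quat \<Rightarrow> quat"  (infixl "\<otimes>\<^sub>q" 70) where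
  "x \<otimes>\<^sub>q y = vector
     [x$1 * y$1 - x$2 * y$2 - x$3 * y$3 - x$4 * y$4,
      x$1 * y$2 + x$2 * y$1 + x$3 * y$4 - x$4 * y$3,
      x$1 * y$3 - x$2 * y$4 + x$3 * y$1 + x$4 * y$2,
      x$1 * y$4 + x$2 * y$3 - x$3 * y$2 + x$4 * y$1]"

definition qinv :: "quat \<Rightarrow> quat" where
  "qinv x = (1 / (x \<bullet> x)) *\<^sub>R vector [x$1, - x$2, - x$3, - x$4]"

subsection \<open>The nearly Kaehler structure of \<open>\<S>\<^sup>3 \<times> \<S>\<^sup>3\<close>\<close>

abbreviation S3xS3 :: "(quat \<times> quat) set" where
  "S3xS3 \<equiv> sphere 0 1 \<times> sphere 0 1"

text \<open>
  The first argument is the base point \<open>(p, q)\<close>, the second a tangent vector \<open>(U, V)\<close>, regarded as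
  an element of the ambient space. The inner product on the product type is the sum of the two
  Euclidean inner products.
\<close>

definition J :: "quat \<times> quat \<Rightarrow> quat \<times> quat \<Rightarrow> quat \<times> quat" where
  "J = (\<lambda>(p, q) (U, V). (1 / sqrt 3) *\<^sub>R
         (2 *\<^sub>R (p \<otimes>\<^sub>q qinv q \<otimes>\<^sub>q V) - U, - (2 *\<^sub>R (q \<otimes>\<^sub>q qinv p \<otimes>\<^sub>q U)) + V))"

definition P :: "quat \<times> quat \<Rightarrow> quat \<times> quat \<Rightarrow> quat \<times> quat" where
  "P = (\<lambda>(p, q) (U, V). (p \<otimes>\<^sub>q qinv q \<otimes>\<^sub>q V, q \<otimes>\<^sub>q qinv p \<otimes>\<^sub>q U))"

definition g :: "quat \<times> quat \<Rightarrow> quat \<times> quat \<Rightarrow> quat \<times> quat \<Rightarrow> real" where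
  "g z Z Z' = (1 / 2) * (Z \<bullet> Z' + J z Z \<bullet> J z Z')"

subsection \<open>Smooth maps and smooth manifolds\<close>

text \<open>These two notions are meant for open sets \<open>S\<close> only.\<close>

primrec Ck_on :: "nat \<Rightarrow> 'a::euclidean_space set \<Rightarrow> ('a \<Rightarrow> 'b::real_normed_vector) \<Rightarrow> bool" where
  "Ck_on 0 S f \<longleftrightarrow> continuous_on S f"
| "Ck_on (Suc k) S f \<longleftrightarrow> f differentiable_on S \<and>
     (\<forall>b\<in>Basis. Ck_on k S (\<lambda>x. frechet_derivative f (at x) b))"

definition smooth_on :: "'a::euclidean_space set \<Rightarrow> ('a \<Rightarrow> 'b::real_normed_vector) \<Rightarrow> bool" where
  "smooth_on S f \<longleftrightarrow> (\<forall>k. Ck_on k S f)"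

text \<open>
  The underlying space of a manifold is a whole type \<open>'m\<close>, and its dimension is the dimension
  of the model space \<open>'e\<close>. A chart is a domain together with a map that is relevant only on
  this domain. The atlas need not be maximal.
\<close>

type_synonym ('m, 'e) chart = "'m set \<times> ('m \<Rightarrow> 'e)"

definition smooth_atlas ::
    "('m::{t2_space, second_countable_topology}, 'e::euclidean_space) chart set \<Rightarrow> bool" where
  "smooth_atlas \<A> \<longleftrightarrow>
     (\<Union>(D, \<phi>)\<in>\<A>. D) = UNIV \<and>
     (\<forall>(D, \<phi>)\<in>\<A>. open D \<and> open (\<phi> ` D) \<and> homeomorphism D (\<phi> ` D) \<phi> (inv_into D \<phi>)) \<and>
     (\<forall>(D, \<phi>)\<in>\<A>. \<forall>(D', \<psi>)\<in>\<A>. smooth_on (\<phi> ` (D \<inter> D')) (\<psi> \<circ> inv_into D \<phi>))"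

definition smooth_map_on ::
    "('m::topological_space, 'e::euclidean_space) chart set \<Rightarrow> 'm set \<Rightarrow>
     ('m \<Rightarrow> 'b::real_normed_vector) \<Rightarrow> bool" where
  "smooth_map_on \<A> W f \<longleftrightarrow> (\<forall>(D, \<phi>)\<in>\<A>. smooth_on (\<phi> ` (D \<inter> W)) (f \<circ> inv_into D \<phi>))"

text \<open>
  Tangent vectors at \<open>x\<close> are the derivations at \<open>x\<close> of the algebra of smooth real functions on the
  manifold. Since HOL functions are total, a derivation is set to 0 outside of this algebra, so
  that equality of tangent vectors is equality of functions.
\<close>

type_synonym 'm tvec = "('m \<Rightarrow> real) \<Rightarrow> real"

definition tangent_space ::
    "('m::topological_space, 'e::euclidean_space) chart set \<Rightarrow> 'm \<Rightarrow> 'm tvec set" where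
  "tangent_space \<A> x = {v.
     (\<forall>h k. smooth_map_on \<A> UNIV h \<longrightarrow> smooth_map_on \<A> UNIV k \<longrightarrow>
        v (\<lambda>y. h y + k y) = v h + v k \<and>
        v (\<lambda>y. h y * k y) = h x * v k + k x * v h) \<and>
     (\<forall>c h. smooth_map_on \<A> UNIV h \<longrightarrow> v (\<lambda>y. c * h y) = c * v h) \<and>
     (\<forall>h. \<not> smooth_map_on \<A> UNIV h \<longrightarrow> v h = 0)}"

definition tscale :: "real \<Rightarrow> 'm tvec \<Rightarrow> 'm tvec"  (infixr "*\<^sub>t" 75) where
  "c *\<^sub>t v = (\<lambda>h. c * v h)"

definition tadd :: "'m tvec \<Rightarrow> 'm tvec \<Rightarrow> 'm tvec"  (infixl "+\<^sub>t" 65) where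
  "u +\<^sub>t v = (\<lambda>h. u h + v h)"

text \<open>
  The differential of a map into a Euclidean space, with \<open>T\<^sub>y \<real>\<^sup>n\<close> identified with \<open>\<real>\<^sup>n\<close>: the
  coordinates of \<open>df(v)\<close> are the derivatives along \<open>v\<close> of the coordinates of \<open>f\<close>.
  The point of tangency is determined by \<open>v\<close> and does not occur.
\<close>

definition diff :: "('m \<Rightarrow> 'b::euclidean_space) \<Rightarrow> 'm tvec \<Rightarrow> 'b" where
  "diff f v = (\<Sum>b\<in>Basis. v (\<lambda>y. f y \<bullet> b) *\<^sub>R b)"

subsection \<open>Lagrangian immersions\<close>

definition immersion ::
    "('m::topological_space, 'e::euclidean_space) chart set \<Rightarrow> ('m \<Rightarrow> quat \<times> quat) \<Rightarrow> bool" where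
  "immersion \<A> f \<longleftrightarrow> range f \<subseteq> S3xS3 \<and> smooth_map_on \<A> UNIV f \<and>
     (\<forall>x. inj_on (diff f) (tangent_space \<A> x))"

definition lagrangian_immersion ::
    "('m::topological_space, 'e::euclidean_space) chart set \<Rightarrow> ('m \<Rightarrow> quat \<times> quat) \<Rightarrow> bool" where
  "lagrangian_immersion \<A> f \<longleftrightarrow> immersion \<A> f \<and> DIM('e) = 3 \<and>
     (\<forall>x. \<forall>X\<in>tangent_space \<A> x. \<forall>Y\<in>tangent_space \<A> x.
        g (f x) (J (f x) (diff f X)) (diff f Y) = 0)"

definition induced_metric ::
    "('m \<Rightarrow> quat \<times> quat) \<Rightarrow> 'm \<Rightarrow> 'm tvec \<Rightarrow> 'm tvec \<Rightarrow> real" where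
  "induced_metric f x X Y = g (f x) (diff f X) (diff f Y)"

definition symmetric_endo ::
    "('m::topological_space, 'e::euclidean_space) chart set \<Rightarrow> ('m \<Rightarrow> quat \<times> quat) \<Rightarrow>
     ('m \<Rightarrow> 'm tvec \<Rightarrow> 'm tvec) \<Rightarrow> bool" where
  "symmetric_endo \<A> f A \<longleftrightarrow>
     (\<forall>x. \<forall>X\<in>tangent_space \<A> x. \<forall>Y\<in>tangent_space \<A> x.
        A x X \<in> tangent_space \<A> x \<and>
        A x (X +\<^sub>t Y) = A x X +\<^sub>t A x Y \<and> (\<forall>c. A x (c *\<^sub>t X) = c *\<^sub>t A x X) \<and>
        induced_metric f x (A x X) Y = induced_metric f x X (A x Y))"

definition corresponding_operators ::
    "('m::topological_space, 'e::euclidean_space) chart set \<Rightarrow> ('m \<Rightarrow> quat \<times> quat) \<Rightarrow>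
     ('m \<Rightarrow> 'm tvec \<Rightarrow> 'm tvec) \<Rightarrow> ('m \<Rightarrow> 'm tvec \<Rightarrow> 'm tvec) \<Rightarrow> bool" where
  "corresponding_operators \<A> f A B \<longleftrightarrow> symmetric_endo \<A> f A \<and> symmetric_endo \<A> f B \<and>
     (\<forall>x. \<forall>X\<in>tangent_space \<A> x.
        P (f x) (diff f X) = diff f (A x X) + J (f x) (diff f (B x X)))"

definition orthonormal_frame ::
    "('m::topological_space, 'e::euclidean_space) chart set \<Rightarrow> ('m \<Rightarrow> quat \<times> quat) \<Rightarrow>
     'm set \<Rightarrow> (nat \<Rightarrow> 'm \<Rightarrow> 'm tvec) \<Rightarrow> bool" where
  "orthonormal_frame \<A> f W E \<longleftrightarrow>
     (\<forall>i\<in>{1, 2, 3}. \<forall>x\<in>W. E i x \<in> tangent_space \<A> x) \<and>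
     (\<forall>i\<in>{1, 2, 3}. \<forall>h. smooth_map_on \<A> UNIV h \<longrightarrow> smooth_map_on \<A> W (\<lambda>x. E i x h)) \<and>
     (\<forall>i\<in>{1, 2, 3}. \<forall>j\<in>{1, 2, 3}. \<forall>x\<in>W.
        induced_metric f x (E i x) (E j x) = (if i = j then 1 else 0))"

text \<open>
  Angle functions are determined pointwise modulo \<open>\<pi>\<close> only, so no regularity is imposed on
  their real-valued representatives.
\<close>

definition eigenframe_with_angles ::
    "('m::topological_space, 'e::euclidean_space) chart set \<Rightarrow> ('m \<Rightarrow> quat \<times> quat) \<Rightarrow>
     ('m \<Rightarrow> 'm tvec \<Rightarrow> 'm tvec) \<Rightarrow> ('m \<Rightarrow> 'm tvec \<Rightarrow> 'm tvec) \<Rightarrow>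
     'm set \<Rightarrow> (nat \<Rightarrow> 'm \<Rightarrow> 'm tvec) \<Rightarrow> (nat \<Rightarrow> 'm \<Rightarrow> real) \<Rightarrow> bool" where
  "eigenframe_with_angles \<A> f A B W E \<theta> \<longleftrightarrow> orthonormal_frame \<A> f W E \<and>
     (\<forall>i\<in>{1, 2, 3}. \<forall>x\<in>W.
        A x (E i x) = cos (2 * \<theta> i x) *\<^sub>t E i x \<and>
        B x (E i x) = sin (2 * \<theta> i x) *\<^sub>t E i x)"

end

theory Submission
  imports Defs
begin

text \<open>
  Everything follows from the behaviour of the swap \<open>\<sigma>(U, V) = (V, U)\<close> towards the structure of
  \<open>\<S>\<^sup>3 \<times> \<S>\<^sup>3\<close>. The formulas for \<open>J\<close> and \<open>P\<close> are symmetric under exchanging the two factors,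
  except that the two components of \<open>J\<close> carry opposite signs. Hence \<open>\<sigma>\<close> commutes with \<open>P\<close> and
  anticommutes with \<open>J\<close> (\<open>P_swap\<close>, \<open>J_swap\<close>); as \<open>g\<close> is quadratic in \<open>J\<close>, the swap is an
  isometry (\<open>g_swap\<close>).

  The map \<open>\<sigma> \<circ> f\<close> has the differential \<open>\<sigma> \<circ> df\<close>. It is therefore an immersion with the same induced
  metric, and it is Lagrangian because the sign of \<open>J\<close> does not affect orthogonality. Applying \<open>\<sigma>\<close> to
  \<open>P df(X) = df(AX) + J df(BX)\<close> gives \<open>P d(\<sigma>f)(X) = d(\<sigma>f)(AX) - J d(\<sigma>f)(BX)\<close>, so that \<open>(A, -B)\<close>
  is a pair of operators corresponding to \<open>\<sigma> \<circ> f\<close>. It is the only such pair, since the images of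
  \<open>df\<close> and of \<open>J df\<close> intersect trivially for a Lagrangian immersion
  (\<open>lagrangian_tangent_normal_decomposition_unique\<close>). On a common eigenvector the pair
  \<open>(cos 2\<theta>, sin 2\<theta>)\<close> thus becomes \<open>(cos 2\<theta>, -sin 2\<theta>)\<close>, and this point of the unit circle
  determines the new angle as \<open>\<pi> - \<theta>\<close> modulo \<open>\<pi>\<close>.
\<close>

section \<open>Quaternion algebra\<close>

lemma vector_nth_4:
  "(vector [a, b, c, d] :: 'a::zero ^ 4) $ 1 = a"
  "(vector [a, b, c, d] :: 'a ^ 4) $ 2 = b"
  "(vector [a, b, c, d] :: 'a ^ 4) $ 3 = c"
  "(vector [a, b, c, d] :: 'a ^ 4) $ 4 = d"
  by (simp_all add: vector_def)

lemma qmult_nth: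
  "(x \<otimes>\<^sub>q y) $ 1 = x$1 * y$1 - x$2 * y$2 - x$3 * y$3 - x$4 * y$4"
  "(x \<otimes>\<^sub>q y) $ 2 = x$1 * y$2 + x$2 * y$1 + x$3 * y$4 - x$4 * y$3"
  "(x \<otimes>\<^sub>q y) $ 3 = x$1 * y$3 - x$2 * y$4 + x$3 * y$1 + x$4 * y$2"
  "(x \<otimes>\<^sub>q y) $ 4 = x$1 * y$4 + x$2 * y$3 - x$3 * y$2 + x$4 * y$1"
  by (simp_all add: qmult_def vector_nth_4)

lemma qmult_assoc: "(x \<otimes>\<^sub>q y) \<otimes>\<^sub>q z = x \<otimes>\<^sub>q (y \<otimes>\<^sub>q z)"
  by (simp add: vec_eq_iff forall_4 qmult_nth algebra_simps)

lemma qmult_add_right: "x \<otimes>\<^sub>q (y + z) = x \<otimes>\<^sub>q y + x \<otimes>\<^sub>q z"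
  by (simp add: vec_eq_iff forall_4 qmult_nth algebra_simps)

lemma qmult_scaleR_right: "x \<otimes>\<^sub>q (c *\<^sub>R y) = c *\<^sub>R (x \<otimes>\<^sub>q y)"
  by (simp add: vec_eq_iff forall_4 qmult_nth algebra_simps)

lemma qmult_qinv_cancel:
  assumes "x \<noteq> 0"
  shows "x \<otimes>\<^sub>q (qinv x \<otimes>\<^sub>q y) = y" and "qinv x \<otimes>\<^sub>q (x \<otimes>\<^sub>q y) = y"
proof -
  let ?c = "vector [x$1, - x$2, - x$3, - x$4] :: quat"
  have scale: "x \<bullet> x \<noteq> 0" using assms by simp
  have n: "x \<bullet> x = x$1 * x$1 + x$2 * x$2 + x$3 * x$3 + x$4 * x$4"
    by (simp add: inner_vec_def sum_4)
  have sl: "(c *\<^sub>R u) \<otimes>\<^sub>q v = c *\<^sub>R (u \<otimes>\<^sub>q v)" for c u v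
    by (simp add: vec_eq_iff forall_4 qmult_nth algebra_simps)
  have "x \<otimes>\<^sub>q (?c \<otimes>\<^sub>q y) = (x \<bullet> x) *\<^sub>R y" "?c \<otimes>\<^sub>q (x \<otimes>\<^sub>q y) = (x \<bullet> x) *\<^sub>R y"
    unfolding n by (simp_all add: vec_eq_iff forall_4 qmult_nth vector_nth_4 algebra_simps)
  then show "x \<otimes>\<^sub>q (qinv x \<otimes>\<^sub>q y) = y" "qinv x \<otimes>\<^sub>q (x \<otimes>\<^sub>q y) = y"
    using scale by (simp_all add: qinv_def sl qmult_scaleR_right)
qed

section \<open>The structure tensors and the swap of the two factors\<close>

lemma linear_J: "linear (J z)"
  by (rule linearI)
    (auto simp: J_def qmult_add_right qmult_scaleR_right algebra_simps split: prod.splits)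

text \<open>
  The two quaternions \<open>p q\<inverse>\<close> and \<open>q p\<inverse>\<close> in the formula for \<open>J\<close> are inverse to each other, so the
  mixed terms of \<open>J\<^sup>2\<close> cancel and each component of \<open>3 J\<^sup>2\<close> is \<open>1 - 4 = -3\<close> times the identity. In
  particular \<open>J\<close> is injective on the whole ambient space.
\<close>

lemma J_J:
  assumes "z \<in> S3xS3"
  shows "J z (J z Z) = - Z"
proof -
  obtain p q U V where [simp]: "z = (p, q)" "Z = (U, V)" by (metis surj_pair)
  have nz: "p \<noteq> 0" "q \<noteq> 0" using assms by auto
  define a where "a = p \<otimes>\<^sub>q qinv q"
  define b where "b = q \<otimes>\<^sub>q qinv p"
  have ab: "a \<otimes>\<^sub>q (b \<otimes>\<^sub>q u) = u" "b \<otimes>\<^sub>q (a \<otimes>\<^sub>q u) = u" for u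
    by (simp_all add: a_def b_def qmult_assoc qmult_qinv_cancel nz)
  have lin: "linear (\<lambda>u. x \<otimes>\<^sub>q u)" for x
    by (rule linearI) (simp_all add: qmult_add_right qmult_scaleR_right)
  note lins = linear_diff[OF lin] linear_neg[OF lin] qmult_add_right qmult_scaleR_right
  have Jz: "J z (u, v) = (1 / sqrt 3) *\<^sub>R (2 *\<^sub>R (a \<otimes>\<^sub>q v) - u, - (2 *\<^sub>R (b \<otimes>\<^sub>q u)) + v)" for u v
    by (simp add: J_def a_def b_def)
  have "J z (J z Z) = (1 / sqrt 3) *\<^sub>R J z (2 *\<^sub>R (a \<otimes>\<^sub>q V) - U, - (2 *\<^sub>R (b \<otimes>\<^sub>q U)) + V)"
    unfolding \<open>Z = (U, V)\<close> Jz[of U V] by (simp only: linear_scale[OF linear_J])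
  also have "\<dots> = (1 / 3) *\<^sub>R (- (3 *\<^sub>R U), - (3 *\<^sub>R V))"
    unfolding Jz by (simp add: lins ab) (simp add: vec_eq_iff)
  finally show ?thesis by simp
qed

lemma P_swap: "P (prod.swap z) (prod.swap Z) = prod.swap (P z Z)"
  by (auto simp: P_def split: prod.splits)

lemma J_swap: "J (prod.swap z) (prod.swap Z) = - prod.swap (J z Z)"
  by (auto simp: J_def algebra_simps split: prod.splits)

lemma inner_swap: "prod.swap Z \<bullet> prod.swap Z' = Z \<bullet> Z'"
  for Z Z' :: "'a::real_inner \<times> 'a"
  by (cases Z; cases Z') (simp add: inner_prod_def)

lemma g_swap: "g (prod.swap z) (prod.swap Z) (prod.swap Z') = g z Z Z'"
  by (simp add: g_def J_swap inner_swap)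

lemma g_self_eq_0D: "g z Z Z = 0 \<Longrightarrow> Z = 0"
  unfolding g_def using inner_ge_zero[of Z] inner_ge_zero[of "J z Z"]
  by (metis add_nonneg_eq_0_iff inner_eq_zero_iff mult_eq_0_iff zero_neq_one divide_eq_0_iff zero_neq_numeral)

lemma g_scaleR_left: "g z (c *\<^sub>R Z) Z' = c * g z Z Z'"
  and g_scaleR_right: "g z Z (c *\<^sub>R Z') = c * g z Z Z'"
  by (simp_all add: g_def linear_scale[OF linear_J] algebra_simps)

lemma linear_swap: "linear (prod.swap :: 'a::real_vector \<times> 'a \<Rightarrow> 'a \<times> 'a)"
  by (rule linearI) (auto simp: prod.swap_def)

lemma bounded_linear_swap:
  "bounded_linear (prod.swap :: 'a::real_normed_vector \<times> 'a \<Rightarrow> 'a \<times> 'a)"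
  unfolding prod.swap_def by (intro bounded_linear_Pair bounded_linear_snd bounded_linear_fst)

section \<open>Smooth maps and their differentials\<close>

text \<open>
  The iterated derivatives of \<open>L \<circ> h\<close> agree with \<open>L\<close> applied to those of \<open>h\<close> on \<open>S\<close> only, so the
  induction has to go over all maps \<open>h'\<close> that equal \<open>L \<circ> h\<close> on \<open>S\<close>.
\<close>

lemma Ck_on_bounded_linear:
  assumes "bounded_linear L" "open S"
  shows "Ck_on k S h \<Longrightarrow> (\<And>x. x \<in> S \<Longrightarrow> h' x = L (h x)) \<Longrightarrow> Ck_on k S h'"
proof (induction k arbitrary: h h')
  case 0
  then show ?case
    using bounded_linear.continuous_on[OF assms(1), of S h] continuous_on_cong[of S S h' "\<lambda>x. L (h x)"]
    by simp
next
  case (Suc k)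
  have deriv: "(h' has_derivative (\<lambda>v. L (frechet_derivative h (at x) v))) (at x)" if "x \<in> S" for x
  proof -
    have "h differentiable (at x)"
      using Suc.prems(1) that assms(2) by (simp add: differentiable_on_eq_differentiable_at)
    then have "(h has_derivative frechet_derivative h (at x)) (at x)"
      by (simp add: frechet_derivative_works)
    then have "((\<lambda>y. L (h y)) has_derivative (\<lambda>v. L (frechet_derivative h (at x) v))) (at x)"
      by (rule bounded_linear.has_derivative[OF assms(1)])
    then show ?thesis
      by (rule has_derivative_transform_within_open[OF _ assms(2) that]) (simp add: Suc.prems(2))
  qed
  then have "h' differentiable_on S"
    using assms(2) by (auto simp: differentiable_on_eq_differentiable_at differentiable_def)
  moreover have "Ck_on k S (\<lambda>x. frechet_derivative h' (at x) b)" if "b \<in> Basis" for b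
    using Suc.prems(1) that by (intro Suc.IH[of "\<lambda>x. frechet_derivative h (at x) b"])
      (auto simp: frechet_derivative_at[OF deriv, symmetric])
  ultimately show ?case by simp
qed

lemma smooth_map_on_bounded_linear:
  assumes "smooth_atlas \<A>" "bounded_linear L" "smooth_map_on \<A> UNIV h"
  shows "smooth_map_on \<A> UNIV (L \<circ> h)"
  unfolding smooth_map_on_def smooth_on_def
proof clarify
  fix D \<phi> k
  assume "(D, \<phi>) \<in> \<A>"
  then have "open (\<phi> ` D)" "Ck_on k (\<phi> ` D) (h \<circ> inv_into D \<phi>)"
    using assms(1,3) by (auto simp: smooth_atlas_def smooth_map_on_def smooth_on_def)
  then show "Ck_on k (\<phi> ` (D \<inter> UNIV)) (L \<circ> h \<circ> inv_into D \<phi>)"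
    using Ck_on_bounded_linear[OF assms(2)] by fastforce
qed

lemma tangent_space_tadd:
  "u \<in> tangent_space \<A> x \<Longrightarrow> v \<in> tangent_space \<A> x \<Longrightarrow> u +\<^sub>t v \<in> tangent_space \<A> x"
  by (simp add: tangent_space_def tadd_def algebra_simps)

lemma tangent_space_tscale:
  "v \<in> tangent_space \<A> x \<Longrightarrow> c *\<^sub>t v \<in> tangent_space \<A> x"
  by (simp add: tangent_space_def tscale_def algebra_simps)

lemma diff_tadd: "diff h (u +\<^sub>t v) = diff h u + diff h v"
  by (simp add: diff_def tadd_def scaleR_left_distrib sum.distrib)

lemma diff_tscale: "diff h (c *\<^sub>t v) = c *\<^sub>R diff h v"
  by (simp add: diff_def tscale_def scaleR_sum_right)

lemma diff_swap: "diff (prod.swap \<circ> h) v = prod.swap (diff h v)"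
  for h :: "'m \<Rightarrow> 'b::euclidean_space \<times> 'b"
proof -
  have Basis_swap: "prod.swap ` Basis = (Basis :: ('b \<times> 'b) set)"
    by (auto simp: Basis_prod_def image_Un image_image)
  have "diff (prod.swap \<circ> h) v = (\<Sum>b\<in>prod.swap ` Basis. v (\<lambda>y. prod.swap (h y) \<bullet> b) *\<^sub>R b)"
    by (simp add: diff_def Basis_swap)
  also have "\<dots> = (\<Sum>b\<in>Basis. v (\<lambda>y. h y \<bullet> b) *\<^sub>R prod.swap b)"
    by (subst sum.reindex) (simp_all add: inner_swap)
  also have "\<dots> = prod.swap (diff h v)"
    by (simp add: diff_def linear_sum[OF linear_swap] linear_scale[OF linear_swap])
  finally show ?thesis .
qed

section \<open>Lagrangian immersions and their operators\<close>

text \<open>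
  This makes the operators corresponding to a Lagrangian immersion unique.
  A vector in the images of both \<open>df\<close> and \<open>J df\<close> is \<open>g\<close>-orthogonal to itself, hence 0.
\<close>

lemma lagrangian_tangent_normal_decomposition_unique:
  assumes lag: "lagrangian_immersion \<A> f"
    and tan: "u \<in> tangent_space \<A> x" "v \<in> tangent_space \<A> x"
      "u' \<in> tangent_space \<A> x" "v' \<in> tangent_space \<A> x"
    and eq: "diff f u + J (f x) (diff f v) = diff f u' + J (f x) (diff f v')"
  shows "u = u' \<and> v = v'"
proof -
  define Z where "Z = diff f u - diff f u'"
  have inj: "inj_on (diff f) (tangent_space \<A> x)" and fx: "f x \<in> S3xS3"
    using lag by (auto simp: lagrangian_immersion_def immersion_def)
  have Z1: "Z = diff f (u +\<^sub>t (-1) *\<^sub>t u')"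
    by (simp add: Z_def diff_tadd diff_tscale)
  have Z2: "Z = J (f x) (diff f (v' +\<^sub>t (-1) *\<^sub>t v))"
    using eq by (simp add: Z_def diff_tadd diff_tscale linear_diff[OF linear_J] algebra_simps)
  have "g (f x) Z Z = 0"
    using lag tan unfolding lagrangian_immersion_def
    by (subst Z2, subst Z1) (simp add: tangent_space_tadd tangent_space_tscale)
  then have "Z = 0" by (rule g_self_eq_0D)
  then have "u = u'"
    using inj tan by (auto simp: Z_def dest: inj_onD)
  moreover have "diff f (v' +\<^sub>t (-1) *\<^sub>t v) = 0"
    using J_J[OF fx, of "diff f (v' +\<^sub>t (-1) *\<^sub>t v)"] Z2 \<open>Z = 0\<close>
    by (simp add: linear_0[OF linear_J])
  then have "v = v'"
    using inj tan by (auto simp: diff_tadd diff_tscale dest: inj_onD)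
  ultimately show ?thesis ..
qed

lemma corresponding_operators_unique:
  assumes "lagrangian_immersion \<A> f"
    and "corresponding_operators \<A> f A B" "corresponding_operators \<A> f A' B'"
    and "X \<in> tangent_space \<A> x"
  shows "A' x X = A x X \<and> B' x X = B x X"
  using assms
  by (intro lagrangian_tangent_normal_decomposition_unique[OF assms(1), of _ x])
    (auto simp: corresponding_operators_def symmetric_endo_def)

lemma induced_metric_swap: "induced_metric (prod.swap \<circ> f) x X Y = induced_metric f x X Y"
  by (simp add: induced_metric_def diff_swap g_swap)

lemma symmetric_endo_swap: "symmetric_endo \<A> (prod.swap \<circ> f) = symmetric_endo \<A> f"
  by (simp add: symmetric_endo_def induced_metric_swap fun_eq_iff)

lemma orthonormal_frame_swap: "orthonormal_frame \<A> (prod.swap \<circ> f) = orthonormal_frame \<A> f"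
  by (simp add: orthonormal_frame_def induced_metric_swap fun_eq_iff)

lemma lagrangian_immersion_swap:
  assumes "smooth_atlas \<A>" "lagrangian_immersion \<A> f"
  shows "lagrangian_immersion \<A> (prod.swap \<circ> f)"
proof -
  have imm: "immersion \<A> f" using assms(2) by (simp add: lagrangian_immersion_def)
  have fx: "f x \<in> S3xS3" for x
    using imm by (auto simp: immersion_def)
  have "(prod.swap \<circ> f) x \<in> S3xS3" for x
    using fx[of x] by (cases "f x") simp
  then have "range (prod.swap \<circ> f) \<subseteq> S3xS3"
    by blast
  moreover have "smooth_map_on \<A> UNIV (prod.swap \<circ> f)"
    using imm by (intro smooth_map_on_bounded_linear[OF assms(1) bounded_linear_swap])
      (simp add: immersion_def)
  moreover have "inj_on (diff (prod.swap \<circ> f)) (tangent_space \<A> x)" for x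
    using imm by (auto simp: immersion_def inj_on_def diff_swap inj_eq[OF inj_swap])
  moreover have "g ((prod.swap \<circ> f) x) (J ((prod.swap \<circ> f) x) (diff (prod.swap \<circ> f) X))
      (diff (prod.swap \<circ> f) Y) = 0"
    if "X \<in> tangent_space \<A> x" "Y \<in> tangent_space \<A> x" for x X Y
  proof -
    have "g ((prod.swap \<circ> f) x) (J ((prod.swap \<circ> f) x) (diff (prod.swap \<circ> f) X))
        (diff (prod.swap \<circ> f) Y) = - g (f x) (J (f x) (diff f X)) (diff f Y)"
      using g_scaleR_left[of "prod.swap (f x)" "-1"] by (simp add: diff_swap J_swap g_swap)
    with that assms(2) show ?thesis by (simp add: lagrangian_immersion_def)
  qed
  ultimately show ?thesis
    using assms(2) by (simp add: lagrangian_immersion_def immersion_def)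
qed

lemma symmetric_endo_neg:
  assumes "symmetric_endo \<A> f B"
  shows "symmetric_endo \<A> f (\<lambda>x X. (-1) *\<^sub>t B x X)"
  unfolding symmetric_endo_def
proof (intro allI ballI conjI)
  fix x X Y c
  assume "X \<in> tangent_space \<A> x" "Y \<in> tangent_space \<A> x"
  with assms have B: "B x X \<in> tangent_space \<A> x" "B x (X +\<^sub>t Y) = B x X +\<^sub>t B x Y"
      "B x (c *\<^sub>t X) = c *\<^sub>t B x X" "induced_metric f x (B x X) Y = induced_metric f x X (B x Y)"
    by (auto simp: symmetric_endo_def)
  show "(-1) *\<^sub>t B x X \<in> tangent_space \<A> x"
    by (rule tangent_space_tscale[OF B(1)])
  show "(-1) *\<^sub>t B x (X +\<^sub>t Y) = (-1) *\<^sub>t B x X +\<^sub>t (-1) *\<^sub>t B x Y"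
    unfolding B(2) by (simp add: tscale_def tadd_def fun_eq_iff)
  show "(-1) *\<^sub>t B x (c *\<^sub>t X) = c *\<^sub>t (-1) *\<^sub>t B x X"
    unfolding B(3) by (simp add: tscale_def fun_eq_iff)
  show "induced_metric f x ((-1) *\<^sub>t B x X) Y = induced_metric f x X ((-1) *\<^sub>t B x Y)"
    using B(4) unfolding induced_metric_def diff_tscale g_scaleR_left g_scaleR_right by simp
qed

text \<open>The sign in front of \<open>B\<close> makes up for the sign by which the swap anticommutes with \<open>J\<close>.\<close>

lemma corresponding_operators_swap:
  assumes "corresponding_operators \<A> f A B"
  shows "corresponding_operators \<A> (prod.swap \<circ> f) A (\<lambda>x X. (-1) *\<^sub>t B x X)"
proof -
  have "P ((prod.swap \<circ> f) x) (diff (prod.swap \<circ> f) X) =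
      diff (prod.swap \<circ> f) (A x X) + J ((prod.swap \<circ> f) x) (diff (prod.swap \<circ> f) ((-1) *\<^sub>t B x X))"
    if "X \<in> tangent_space \<A> x" for x X
  proof -
    have "P (f x) (diff f X) = diff f (A x X) + J (f x) (diff f (B x X))"
      using assms that by (simp add: corresponding_operators_def)
    then show ?thesis
      by (simp add: diff_swap P_swap J_swap diff_tscale linear_add[OF linear_swap]
          linear_neg[OF linear_swap] linear_neg[OF linear_J])
  qed
  then show ?thesis
    using assms symmetric_endo_neg
    by (auto simp: corresponding_operators_def symmetric_endo_swap)
qed

text \<open>
  The zero tangent vector is the zero function, so a nonzero one has a test function \<open>h\<close> at which
  scalar multiples of it can be compared.
\<close>

lemma orthonormal_frame_nonzero:
  assumes "orthonormal_frame \<A> f W E" "i \<in> {1, 2, 3}" "x \<in> W"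
  shows "\<exists>h. E i x h \<noteq> 0"
proof (rule ccontr)
  assume "\<nexists>h. E i x h \<noteq> 0"
  then have "diff f (E i x) = 0" by (simp add: diff_def)
  then have "induced_metric f x (E i x) (E i x) = 0"
    using g_scaleR_left[of "f x" 0] by (simp add: induced_metric_def)
  moreover have "induced_metric f x (E i x) (E i x) = 1"
    using assms by (auto simp: orthonormal_frame_def)
  ultimately show False by simp
qed

text \<open>
  An eigenvalue pair \<open>(cos 2\<theta>, sin 2\<theta>)\<close> fixes \<open>2\<theta>\<close> modulo \<open>2\<pi>\<close>, whence the modulus \<open>\<pi>\<close> for \<open>\<theta>\<close>.
\<close>

lemma eigenframe_angles_unique:
  assumes "eigenframe_with_angles \<A> f A B W E \<theta>" "eigenframe_with_angles \<A> f A B W E \<theta>'"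
    and "i \<in> {1, 2, 3}" "x \<in> W"
  shows "[\<theta>' i x = \<theta> i x] (rmod pi)"
proof -
  obtain h where h: "E i x h \<noteq> 0"
    using orthonormal_frame_nonzero assms unfolding eigenframe_with_angles_def by blast
  have "cos (2 * \<theta>' i x) *\<^sub>t E i x = cos (2 * \<theta> i x) *\<^sub>t E i x"
    "sin (2 * \<theta>' i x) *\<^sub>t E i x = sin (2 * \<theta> i x) *\<^sub>t E i x"
    using assms unfolding eigenframe_with_angles_def by metis+
  then have "cos (2 * \<theta>' i x) = cos (2 * \<theta> i x)" "sin (2 * \<theta>' i x) = sin (2 * \<theta> i x)"
    using h by (auto simp: tscale_def dest!: fun_cong[where x = h])
  then obtain n :: int where "2 * \<theta>' i x = 2 * \<theta> i x + 2 * pi * n"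
    using sin_cos_eq_iff by metis
  then have "\<theta> i x = \<theta>' i x + of_int (- n) * pi"
    by (simp add: algebra_simps)
  then show ?thesis
    unfolding rcong_altdef by blast
qed

lemma eigenframe_with_angles_swap:
  assumes "lagrangian_immersion \<A> (prod.swap \<circ> f)"
    and "corresponding_operators \<A> f A B" "corresponding_operators \<A> (prod.swap \<circ> f) A' B'"
    and "eigenframe_with_angles \<A> f A B W E \<theta>"
  shows "eigenframe_with_angles \<A> (prod.swap \<circ> f) A' B' W E (\<lambda>i x. pi - \<theta> i x)"
proof -
  have "A' x (E i x) = cos (2 * (pi - \<theta> i x)) *\<^sub>t E i x \<and>
      B' x (E i x) = sin (2 * (pi - \<theta> i x)) *\<^sub>t E i x" if "i \<in> {1, 2, 3}" "x \<in> W" for i x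
  proof -
    have "E i x \<in> tangent_space \<A> x"
      using assms(4) that by (auto simp: eigenframe_with_angles_def orthonormal_frame_def)
    then have "A' x (E i x) = A x (E i x)" "B' x (E i x) = (-1) *\<^sub>t B x (E i x)"
      using corresponding_operators_unique[OF assms(1) corresponding_operators_swap[OF assms(2)]
          assms(3)] by auto
    moreover have "A x (E i x) = cos (2 * \<theta> i x) *\<^sub>t E i x" "B x (E i x) = sin (2 * \<theta> i x) *\<^sub>t E i x"
      using assms(4) that by (auto simp: eigenframe_with_angles_def)
    moreover have "cos (2 * (pi - \<theta> i x)) = cos (2 * \<theta> i x)"
        "sin (2 * (pi - \<theta> i x)) = - sin (2 * \<theta> i x)"
      by (simp_all add: right_diff_distrib cos_diff sin_diff)
    ultimately show ?thesis by (simp add: tscale_def fun_eq_iff)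
  qed
  then show ?thesis
    using assms(4) by (auto simp: eigenframe_with_angles_def orthonormal_frame_swap)
qed

theorem theorem3:
  fixes \<A> :: "('m::{t2_space, second_countable_topology}, 'e::euclidean_space) chart set"
    and p q :: "'m \<Rightarrow> quat"
    and f f' :: "'m \<Rightarrow> quat \<times> quat"
  assumes "smooth_atlas \<A>"
    and "f = (\<lambda>x. (p x, q x))"
    and "f' = (\<lambda>x. (q x, p x))"
    and "lagrangian_immersion \<A> f"
  shows "lagrangian_immersion \<A> f' \<and>
    (\<forall>x. \<forall>X\<in>tangent_space \<A> x. \<forall>Y\<in>tangent_space \<A> x.
       induced_metric f' x X Y = induced_metric f x X Y) \<and>
    (\<forall>A B. corresponding_operators \<A> f A B \<longrightarrow>
       (\<exists>A' B'. corresponding_operators \<A> f' A' B') \<and>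
       (\<forall>A' B'. corresponding_operators \<A> f' A' B' \<longrightarrow>
          (\<forall>W E \<theta>. open W \<longrightarrow> eigenframe_with_angles \<A> f A B W E \<theta> \<longrightarrow>
             eigenframe_with_angles \<A> f' A' B' W E (\<lambda>i x. pi - \<theta> i x) \<and>
             (\<forall>\<theta>'. eigenframe_with_angles \<A> f' A' B' W E \<theta>' \<longrightarrow>
                (\<forall>i\<in>{1, 2, 3}. \<forall>x\<in>W. [\<theta>' i x = pi - \<theta> i x] (rmod pi))))))"
proof -
  have f': "f' = prod.swap \<circ> f"
    using assms(2,3) by (simp add: fun_eq_iff)
  have lag: "lagrangian_immersion \<A> f'"
    unfolding f' by (rule lagrangian_immersion_swap[OF assms(1,4)])
  have metric: "induced_metric f' x X Y = induced_metric f x X Y" for x X Y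
    unfolding f' by (rule induced_metric_swap)
  have operators: "\<exists>A' B'. corresponding_operators \<A> f' A' B'"
    if "corresponding_operators \<A> f A B" for A B
    unfolding f' using corresponding_operators_swap[OF that] by blast
  have eigenframe: "eigenframe_with_angles \<A> f' A' B' W E (\<lambda>i x. pi - \<theta> i x)"
    if "corresponding_operators \<A> f A B" "corresponding_operators \<A> f' A' B'"
      "eigenframe_with_angles \<A> f A B W E \<theta>" for A B A' B' W E \<theta>
    using eigenframe_with_angles_swap lag that unfolding f' by blast
  have angles: "[\<theta>' i x = pi - \<theta> i x] (rmod pi)"
    if "corresponding_operators \<A> f A B" "corresponding_operators \<A> f' A' B'"
      "eigenframe_with_angles \<A> f A B W E \<theta>" "eigenframe_with_angles \<A> f' A' B' W E \<theta>'"
      "i \<in> {1, 2, 3}" "x \<in> W" for A B A' B' W E \<theta> \<theta>' i x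
    using eigenframe_angles_unique[OF eigenframe[OF that(1-3)] that(4-6)] .
  show ?thesis
    by (intro conjI allI impI ballI)
      (rule lag metric | (rule operators eigenframe angles; assumption))+
qed

end
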